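(* Let $p$ be the probability function defined by a Bayesian network over a finite set $V$ of discrete variables, and let $\mathcal{T}$ be a junction tree for the network. Let $x=p(b_i\mid\pi)$ be a parameter of the network, where $b_i$ is a value of a variable $B\in V$ with domain $\{b_1,\dots,b_m\}$ and $\pi$ is a combination of values of the parents $\Pi=\mathrm{pa}(B)$; assume that the initially specified value satisfies $0<p(b_i\mid\pi)<1$. Suppose that evidence $e$ has been processed in $\mathcal{T}$ by an inward and subsequent outward propagation. Let $K$ be a clique of $\mathcal{T}$ with $\{B\}\cup\Pi\subseteq K$, and let $\phi_K^*=p(K,e)$ be the potential of $K$ after the propagation. Then, as a function of $x\in[0,1]$, $$p(e)(x)=\gamma x+\delta,$$ with $$\gamma=\frac{\sum_{K:b_i,\pi}\phi^*_K}{p(b_i\mid\pi)}-\sum_{j\neq i}\frac{\sum_{K:b_j,\pi}\phi^*_K}{1-p(b_i\mid\pi)},\qquad \delta=\sum_{j\neq i}\frac{\sum_{K:b_j,\pi}\phi^*_K}{1-p(b_i\mid\pi)}+\sum_{K:\Pi\neq\pi}\phi^*_K .$$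
   Context: A Bayesian network over a finite set $V$ of variables with finite domains consists of a directed acyclic graph on $V$ and, for each $X\in V$ and each combination of values of its parents $\mathrm{pa}(X)$, a conditional probability distribution on $\mathrm{dom}(X)$ whose entries are the parameters of the network. It defines the joint probability function $p(V)=\prod_{X\in V}p(X\mid \mathrm{pa}(X))$. Evidence $e$ is an assignment of values to some subset of the variables. Co-variation convention: the parameter $p(b_i\mid\pi)$ is varied to an arbitrary value $x\in[0,1]$, and the other parameters of the same conditional distribution are scaled proportionally: $$p(b_j\mid\pi)(x)=\begin{cases}x & j=i,\\ p(b_j\mid\pi)\,\dfrac{1-x}{1-p(b_i\mid\pi)} & j\ne i,\end{cases}$$ where $p(b_i\mid\pi)<1$. All other parameters stay fixed. Symbols $p(\cdot\mid\cdot)$ without an argument $x$ denote the initially specified values. $p(e)(x)$ denotes the probability of the evidence $e$ under the network with the varied parameters. Potentials: after the described propagation in the junction tree (performed with the initial parameter values), the potential of a clique $K\subseteq V$ is the table $\phi_K^*=p(K,e)$ that assigns to each configuration $k$ of the variables in $K$ the initial probability of the joint event "$K=k$ and $e$" (zero if inconsistent). Summation notation: $\sum_{K:b_j,\pi}\phi^*_K$ is the sum of $\phi^*_K$ over all configurations of $K$ with $B=b_j$ and $\Pi=\pi$; $\sum_{K:\Pi\ne\pi}\phi^*_K$ is the sum over all configurations of $K$ with $\Pi\neq\pi$. *)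

theory Defs
  imports Complex_Main "HOL-Library.FuncSet"
begin

(* All variables draw their values from one type 'a, but each variable has its own
   finite domain.  "param N X \<rho> a" is the parameter p(X = a | pa(X) = \<rho>). *)
record ('v, 'a) bayes_net =
  vars :: "'v set"
  arcs :: "('v \<times> 'v) set"
  vals :: "'v \<Rightarrow> 'a set"
  param :: "'v \<Rightarrow> ('v \<Rightarrow> 'a) \<Rightarrow> 'a \<Rightarrow> real"

definition parents :: "('v, 'a) bayes_net \<Rightarrow> 'v \<Rightarrow> 'v set" where
  "parents N X = {Y. (Y, X) \<in> arcs N}"

(* A configuration of a set K of variables is extensional (undefined outside K), so that
   equality of functions is equality of configurations and "restrict v K" is the
   configuration of K that v induces. *)
definition configs :: "('v, 'a) bayes_net \<Rightarrow> 'v set \<Rightarrow> ('v \<Rightarrow> 'a) set" where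
  "configs N K = (\<Pi>\<^sub>E X\<in>K. vals N X)"

definition bayesian_network :: "('v, 'a) bayes_net \<Rightarrow> bool" where
  "bayesian_network N \<longleftrightarrow>
     finite (vars N) \<and>
     arcs N \<subseteq> vars N \<times> vars N \<and> acyclic (arcs N) \<and>
     (\<forall>X\<in>vars N. finite (vals N X) \<and> vals N X \<noteq> {}) \<and>
     (\<forall>X\<in>vars N. \<forall>\<rho>\<in>configs N (parents N X).
        (\<forall>a\<in>vals N X. 0 \<le> param N X \<rho> a) \<and> (\<Sum>a\<in>vals N X. param N X \<rho> a) = 1)"

definition joint :: "('v, 'a) bayes_net \<Rightarrow> ('v \<Rightarrow> 'a) \<Rightarrow> real" where
  "joint N v = (\<Prod>X\<in>vars N. param N X (restrict v (parents N X)) (v X))"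

definition prob :: "('v, 'a) bayes_net \<Rightarrow> (('v \<Rightarrow> 'a) \<Rightarrow> bool) \<Rightarrow> real" where
  "prob N A = (\<Sum>v\<in>{v \<in> configs N (vars N). A v}. joint N v)"

definition evidence :: "('v, 'a) bayes_net \<Rightarrow> ('v \<rightharpoonup> 'a) \<Rightarrow> bool" where
  "evidence N e \<longleftrightarrow> (\<forall>X a. e X = Some a \<longrightarrow> X \<in> vars N \<and> a \<in> vals N X)"

definition agrees :: "('v \<rightharpoonup> 'a) \<Rightarrow> ('v \<Rightarrow> 'a) \<Rightarrow> bool" where
  "agrees e v \<longleftrightarrow> (\<forall>X a. e X = Some a \<longrightarrow> v X = a)"

definition prob_evidence :: "('v, 'a) bayes_net \<Rightarrow> ('v \<rightharpoonup> 'a) \<Rightarrow> real" where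
  "prob_evidence N e = prob N (agrees e)"

(* The network in which p(B = b | pa(B) = \<pi>) is set to x and the other parameters of
   the same conditional distribution are scaled proportionally. *)
definition covary ::
  "('v, 'a) bayes_net \<Rightarrow> 'v \<Rightarrow> ('v \<Rightarrow> 'a) \<Rightarrow> 'a \<Rightarrow> real \<Rightarrow> ('v, 'a) bayes_net" where
  "covary N B \<pi> b x = N\<lparr>param := (\<lambda>X \<rho> a.
     if X = B \<and> \<rho> = \<pi>
     then if a = b then x else param N B \<pi> a * ((1 - x) / (1 - param N B \<pi> b))
     else param N X \<rho> a)\<rparr>"

definition simple_path :: "'n set set \<Rightarrow> 'n \<Rightarrow> 'n list \<Rightarrow> 'n \<Rightarrow> bool" where
  "simple_path E u ps w \<longleftrightarrow>
     ps \<noteq> [] \<and> hd ps = u \<and> last ps = w \<and> distinct ps \<and> successively (\<lambda>s t. {s, t} \<in> E) ps"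

(* Graph_Theory's tree only excludes directed cycles, so it does not describe undirected trees. *)
definition undirected_tree :: "'n set \<Rightarrow> 'n set set \<Rightarrow> bool" where
  "undirected_tree C E \<longleftrightarrow>
     finite C \<and> C \<noteq> {} \<and> E \<subseteq> {{u, w} |u w. u \<in> C \<and> w \<in> C \<and> u \<noteq> w} \<and>
     (\<forall>u\<in>C. \<forall>w\<in>C. \<exists>!ps. simple_path E u ps w)"

(* C is the set of cliques and E the set of undirected edges of the tree.  The third
   conjunct says that the tree fits the network: every family, i.e. a variable with its
   parents, lies in a clique.  The last one is the running intersection property. *)
definition junction_tree ::
  "('v, 'a) bayes_net \<Rightarrow> 'v set set \<Rightarrow> 'v set set set \<Rightarrow> bool" where
  "junction_tree N C E \<longleftrightarrow>
     undirected_tree C E \<and>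
     (\<forall>K\<in>C. K \<subseteq> vars N) \<and>
     (\<forall>X\<in>vars N. \<exists>K\<in>C. insert X (parents N X) \<subseteq> K) \<and>
     (\<forall>K\<in>C. \<forall>L\<in>C. \<forall>ps. simple_path E K ps L \<longrightarrow> (\<forall>M\<in>set ps. K \<inter> L \<subseteq> M))"

(* The state of the clique potentials after evidence e has been processed by an inward and
   an outward propagation: the potential of each clique K is the table p(K, e). *)
definition propagated ::
  "('v, 'a) bayes_net \<Rightarrow> ('v \<rightharpoonup> 'a) \<Rightarrow> 'v set set \<Rightarrow> ('v set \<Rightarrow> ('v \<Rightarrow> 'a) \<Rightarrow> real) \<Rightarrow> bool" where
  "propagated N e C \<phi> \<longleftrightarrow>
     (\<forall>K\<in>C. \<forall>k\<in>configs N K. \<phi> K k = prob N (\<lambda>v. restrict v K = k \<and> agrees e v))"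

end

theory Submission
  imports Defs
begin

text \<open>Co-variation multiplies the joint probability of a configuration by a factor that depends
  only on its restriction to the family of \<open>B\<close>: it is \<open>x / p\<close> if the family shows \<open>(b, \<pi>)\<close>,
  \<open>(1 - x) / (1 - p)\<close> if it shows \<open>(b', \<pi>)\<close> with \<open>b' \<noteq> b\<close>, and \<open>1\<close> otherwise, where \<open>p\<close> is the initial
  value. Splitting \<open>p(e)(x)\<close> along these three cases makes it linear in \<open>x\<close>, and as the family lies
  in \<open>K\<close>, each part is a marginal of \<open>p(K, e)\<close>.\<close>

lemma finite_configs:
  assumes "bayesian_network N" and "K \<subseteq> vars N"
  shows "finite (configs N K)"
  unfolding configs_def
  by (rule finite_PiE) (use assms in \<open>auto simp: bayesian_network_def intro: finite_subset\<close>)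

lemma restrict_in_configs:
  "v \<in> configs N L \<Longrightarrow> K \<subseteq> L \<Longrightarrow> restrict v K \<in> configs N K"
  by (auto simp: configs_def)

lemma prob_cong:
  "(\<And>v. v \<in> configs N (vars N) \<Longrightarrow> A v \<longleftrightarrow> A' v) \<Longrightarrow> prob N A = prob N A'"
  unfolding prob_def by (rule sum.cong) auto

text \<open>Regrouping the defining sum of \<open>prob\<close> by the value of \<open>f\<close>
  gives additivity over its fibres. This serves for two choices of \<open>f\<close>: the restriction
  to a clique, and the value of \<open>B\<close>.\<close>

lemma prob_fibres:
  assumes "bayesian_network N" and "finite I"
  shows "prob N (\<lambda>v. f v \<in> I \<and> A v) = (\<Sum>i\<in>I. prob N (\<lambda>v. f v = i \<and> A v))"
proof -
  let ?S = "{v \<in> configs N (vars N). f v \<in> I \<and> A v}"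
  have "finite ?S"
    using finite_configs[OF assms(1) subset_refl] by simp
  then have "(\<Sum>i\<in>I. \<Sum>v\<in>{v \<in> ?S. f v = i}. joint N v) = sum (joint N) ?S"
    using assms(2) by (intro sum.group) auto
  moreover have "{v \<in> ?S. f v = i} = {v \<in> configs N (vars N). f v = i \<and> A v}" if "i \<in> I" for i
    using that by auto
  ultimately show ?thesis
    unfolding prob_def by simp
qed

text \<open>This turns sums of potentials into probabilities: the events
  \<open>restrict v K = k\<close> are the fibres of restriction to \<open>K\<close>, and every
  restriction lies in \<open>configs N K\<close> because \<open>K\<close> consists of network
  variables.\<close>

lemma sum_propagated:
  assumes "bayesian_network N" and "propagated N e C \<phi>" and "K \<in> C" and "K \<subseteq> vars N"
  shows "(\<Sum>k\<in>{k \<in> configs N K. Q k}. \<phi> K k) = prob N (\<lambda>v. Q (restrict v K) \<and> agrees e v)"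
proof -
  let ?I = "{k \<in> configs N K. Q k}"
  have "(\<Sum>k\<in>?I. \<phi> K k) = (\<Sum>k\<in>?I. prob N (\<lambda>v. restrict v K = k \<and> agrees e v))"
    using assms(2,3) by (intro sum.cong) (auto simp: propagated_def)
  also have "\<dots> = prob N (\<lambda>v. restrict v K \<in> ?I \<and> agrees e v)"
    using assms(1) finite_configs[OF assms(1,4)] by (intro prob_fibres[symmetric]) auto
  also have "\<dots> = prob N (\<lambda>v. Q (restrict v K) \<and> agrees e v)"
    using assms(4) by (intro prob_cong) (auto dest: restrict_in_configs)
  finally show ?thesis .
qed

text \<open>Only the factor of \<open>B\<close> in the product changes. Splitting it off leaves a
  comparison of single parameters, where the new value \<open>x\<close> is written as the old value
  times \<open>x / param N B \<pi> b\<close>.\<close>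

lemma joint_covary:
  assumes "finite (vars N)" and "B \<in> vars N" and "param N B \<pi> b \<noteq> 0"
  shows "joint (covary N B \<pi> b x) v = joint N v *
    (if restrict v (parents N B) = \<pi>
     then if v B = b then x / param N B \<pi> b else (1 - x) / (1 - param N B \<pi> b)
     else 1)"
proof -
  have vars: "vars (covary N B \<pi> b x) = vars N"
    and parents: "parents (covary N B \<pi> b x) X = parents N X" for X
    by (simp_all add: covary_def parents_def)
  have "param (covary N B \<pi> b x) X = param N X" if "X \<noteq> B" for X
    using that by (simp add: covary_def)
  then show ?thesis
    using assms unfolding joint_def vars parents
    by (simp add: prod.remove[OF assms(1,2)]) (auto simp: covary_def)
qed

lemma prob_covary:
  assumes "bayesian_network N" and "B \<in> vars N" and "param N B \<pi> b \<noteq> 0"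
  shows "prob (covary N B \<pi> b x) A =
    x / param N B \<pi> b * prob N (\<lambda>v. v B = b \<and> restrict v (parents N B) = \<pi> \<and> A v)
    + (1 - x) / (1 - param N B \<pi> b) *
        prob N (\<lambda>v. v B \<noteq> b \<and> restrict v (parents N B) = \<pi> \<and> A v)
    + prob N (\<lambda>v. restrict v (parents N B) \<noteq> \<pi> \<and> A v)"
proof -
  have fin: "finite (configs N (vars N))" "finite (vars N)"
    using assms(1) finite_configs[OF assms(1)] by (auto simp: bayesian_network_def)
  have "configs (covary N B \<pi> b x) (vars (covary N B \<pi> b x)) = configs N (vars N)"
    by (simp add: covary_def configs_def)
  then show ?thesis
    unfolding prob_def
    \<comment> \<open>Writing each filtered sum as a sum of conditionals over all configurations
      reduces the identity to a pointwise case distinction.\<close>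
    by (auto simp: joint_covary[OF fin(2) assms(2,3)] fin(1) sum.inter_filter sum_distrib_left
        simp flip: sum.distrib intro!: sum.cong)
qed

theorem corollary1:
  fixes N :: "('v, 'a) bayes_net"
    and C :: "'v set set" and E :: "'v set set set"
    and B :: 'v and b :: 'a and \<pi> :: "'v \<Rightarrow> 'a"
    and e :: "'v \<rightharpoonup> 'a"
    and \<phi> :: "'v set \<Rightarrow> ('v \<Rightarrow> 'a) \<Rightarrow> real" and K :: "'v set"
  assumes "bayesian_network N"
    and "junction_tree N C E"
    and "B \<in> vars N" and "b \<in> vals N B" and "\<pi> \<in> configs N (parents N B)"
    and "0 < param N B \<pi> b" and "param N B \<pi> b < 1"
    and "evidence N e"
    and "propagated N e C \<phi>"
    and "K \<in> C" and "{B} \<union> parents N B \<subseteq> K"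
  shows
    "let S = (\<lambda>b'. \<Sum>k\<in>{k \<in> configs N K. k B = b' \<and> restrict k (parents N B) = \<pi>}. \<phi> K k);
         \<gamma> = S b / param N B \<pi> b
               - (\<Sum>b'\<in>vals N B - {b}. S b' / (1 - param N B \<pi> b));
         \<delta> = (\<Sum>b'\<in>vals N B - {b}. S b' / (1 - param N B \<pi> b))
               + (\<Sum>k\<in>{k \<in> configs N K. restrict k (parents N B) \<noteq> \<pi>}. \<phi> K k)
     in \<forall>x\<in>{0..1}. prob_evidence (covary N B \<pi> b x) e = \<gamma> * x + \<delta>"
proof -
  define p where "p = param N B \<pi> b"
  define S where
    "S b' = (\<Sum>k\<in>{k \<in> configs N K. k B = b' \<and> restrict k (parents N B) = \<pi>}. \<phi> K k)" for b'
  define T where "T = (\<Sum>k\<in>{k \<in> configs N K. restrict k (parents N B) \<noteq> \<pi>}. \<phi> K k)"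
  have K: "K \<subseteq> vars N"
    using assms(2,10) by (auto simp: junction_tree_def)
  \<comment> \<open>Hence restricting first to \<open>K\<close> and then to the parents is the same
    as restricting to the parents directly.\<close>
  have family: "B \<in> K" "K \<inter> parents N B = parents N B"
    using assms(11) by auto
  note marginal = sum_propagated[OF assms(1,9,10) K]
  have S: "S b' = prob N (\<lambda>v. v B = b' \<and> restrict v (parents N B) = \<pi> \<and> agrees e v)" for b'
    unfolding S_def marginal using family by (simp add: Int_absorb1)
  have T: "T = prob N (\<lambda>v. restrict v (parents N B) \<noteq> \<pi> \<and> agrees e v)"
    unfolding T_def marginal using family by simp
  have "finite (vals N B)"
    using assms(1,3) by (simp add: bayesian_network_def)
  then have "(\<Sum>b'\<in>vals N B - {b}. S b') =
      prob N (\<lambda>v. v B \<in> vals N B - {b} \<and> restrict v (parents N B) = \<pi> \<and> agrees e v)"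
    unfolding S by (intro prob_fibres[symmetric] assms(1)) simp
  also have "\<dots> = prob N (\<lambda>v. v B \<noteq> b \<and> restrict v (parents N B) = \<pi> \<and> agrees e v)"
    \<comment> \<open>A configuration always gives \<open>B\<close> a value in
      \<open>vals N B\<close>, so only the exclusion of \<open>b\<close> remains.\<close>
    using assms(3) by (intro prob_cong) (auto simp: configs_def)
  finally have rest: "(\<Sum>b'\<in>vals N B - {b}. S b') = \<dots>" .
  have "prob_evidence (covary N B \<pi> b x) e =
      x / p * S b + (1 - x) / (1 - p) * (\<Sum>b'\<in>vals N B - {b}. S b') + T" for x
    \<comment> \<open>\<open>rest\<close> is applied before \<open>S\<close>, since unfolding
      \<open>S\<close> would rewrite the summands on its left-hand side.\<close>
    unfolding prob_evidence_def rest unfolding S T p_def using assms(1,3,6) by (intro prob_covary) auto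
  then have "prob_evidence (covary N B \<pi> b x) e =
      (S b / p - (\<Sum>b'\<in>vals N B - {b}. S b' / (1 - p))) * x
      + ((\<Sum>b'\<in>vals N B - {b}. S b' / (1 - p)) + T)" for x
    \<comment> \<open>With the division by \<open>1 - p\<close> taken out of the sum, the term in
      \<open>1 - x\<close> splits into a slope and a constant of opposite sign.\<close>
    by (simp add: algebra_simps diff_divide_distrib flip: sum_divide_distrib)
  then show ?thesis
    unfolding Let_def S_def T_def p_def by blast
qed

end
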